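(* For all integers $k\ge 2$ and $n\ge 1$, $$\mathrm{HB}_k(n)\le n-\sqrt{2.43(n-1)}.$$
   Context: A partial word over an alphabet $A$ is a finite word over $A\cup\{\diamondsuit\}$, $\diamondsuit\notin A$ a hole symbol. Two partial words of equal length are compatible if they agree at every position where both have letters (not holes). A partial word is unbordered if no nonempty proper prefix is compatible with the proper suffix of the same length. $\mathrm{HB}_k(n)$ is the maximum number of holes an unbordered partial word of length $n$ over an alphabet of size $k$ can have. *)

theory Defs
  imports Complex_Main
begin

text \<open>Partial words are lists over \<^typ>\<open>'a option\<close>, with \<^term>\<open>None\<close> as the hole symbol.\<close>

type_synonym 'a pword = "'a option list"

definition pword_over :: "'a set \<Rightarrow> 'a pword \<Rightarrow> bool" where
  "pword_over A w \<longleftrightarrow> set w \<subseteq> insert None (Some ` A)"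

definition compatible :: "'a pword \<Rightarrow> 'a pword \<Rightarrow> bool" where
  "compatible u v \<longleftrightarrow> length u = length v \<and>
     (\<forall>i < length u. u ! i \<noteq> None \<and> v ! i \<noteq> None \<longrightarrow> u ! i = v ! i)"

definition unbordered :: "'a pword \<Rightarrow> bool" where
  "unbordered w \<longleftrightarrow>
     (\<forall>m. 0 < m \<and> m < length w \<longrightarrow> \<not> compatible (take m w) (drop (length w - m) w))"

definition holes :: "'a pword \<Rightarrow> nat" where
  "holes w = card {i. i < length w \<and> w ! i = None}"

definition hole_counts :: "'a set \<Rightarrow> nat \<Rightarrow> nat set" where
  "hole_counts A n = {holes w |w. length w = n \<and> pword_over A w \<and> unbordered w}"

text \<open>
  \<open>HB\<close> uses the alphabet \<open>{0, \<dots>, k - 1}\<close>; by \<open>Max_hole_counts_eq_HB\<close> below, any other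
  alphabet of size \<open>k\<close> yields the same number. The maximum is over a finite set, which is
  nonempty for \<open>k \<ge> 2\<close>.
\<close>

definition HB :: "nat \<Rightarrow> nat \<Rightarrow> nat" where
  "HB k n = Max (hole_counts {..<k} n)"

lemma finite_hole_counts: "finite (hole_counts A n)"
proof (rule finite_subset)
  show "hole_counts A n \<subseteq> {..n}"
  proof
    fix h assume "h \<in> hole_counts A n"
    then obtain w :: "'a pword" where w: "h = holes w" "length w = n"
      by (auto simp: hole_counts_def)
    have "card {i. i < length w \<and> w ! i = None} \<le> card {..<length w}"
      by (rule card_mono) auto
    then show "h \<in> {..n}" using w by (simp add: holes_def)
  qed
qed simp

lemma hole_counts_nonempty:
  assumes "a \<in> A" "b \<in> A" "a \<noteq> b"
  shows "hole_counts A n \<noteq> {}"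
proof (cases n)
  case 0
  then have "holes ([] :: 'a pword) \<in> hole_counts A n"
    by (auto simp: hole_counts_def pword_over_def unbordered_def intro!: exI[of _ "[]"])
  then show ?thesis by blast
next
  case (Suc m)
  let ?w = "Some a # replicate m (Some b)"
  have "unbordered ?w"
    unfolding unbordered_def
  proof (intro allI impI)
    fix l assume l: "0 < l \<and> l < length ?w"
    have "take l ?w ! 0 = Some a" using l by simp
    moreover have "drop (length ?w - l) ?w ! 0 = Some b"
      using l by (simp add: nth_Cons')
    ultimately show "\<not> compatible (take l ?w) (drop (length ?w - l) ?w)"
      using l assms(3) unfolding compatible_def
      by (auto simp del: take_Suc_Cons drop_Suc_Cons intro!: exI[of _ 0])
  qed
  moreover have "pword_over A ?w" using assms by (auto simp: pword_over_def)
  ultimately have "holes ?w \<in> hole_counts A n"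
    unfolding hole_counts_def using Suc by (auto intro!: exI[of _ ?w])
  then show ?thesis by blast
qed

lemma hole_counts_subset:
  assumes "inj_on f A" "f ` A \<subseteq> B"
  shows "hole_counts A n \<subseteq> hole_counts B n"
proof
  fix h assume "h \<in> hole_counts A n"
  then obtain w where w: "h = holes w" "length w = n" "pword_over A w" "unbordered w"
    by (auto simp: hole_counts_def)
  let ?g = "map_option f"
  let ?v = "map ?g w"
  have eq: "?g x = ?g y \<longleftrightarrow> x = y" if "x \<in> set w" "y \<in> set w" for x y
    using that w(3) assms(1)
    by (cases x; cases y) (auto simp: pword_over_def dest: inj_onD)
  have comp: "compatible (map ?g p) (map ?g q) \<longleftrightarrow> compatible p q"
    if "set p \<subseteq> set w" "set q \<subseteq> set w" for p q
  proof -
    have "?g (p ! i) = ?g (q ! i) \<longleftrightarrow> p ! i = q ! i"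
      if "i < length p" "length p = length q" for i
      using that \<open>set p \<subseteq> set w\<close> \<open>set q \<subseteq> set w\<close> by (intro eq) (auto simp: subset_iff)
    then show ?thesis
      unfolding compatible_def by (simp del: not_None_eq cong: conj_cong)
  qed
  have "unbordered ?v"
    using w(4) unfolding unbordered_def
    by (simp add: take_map drop_map comp set_take_subset set_drop_subset)
  moreover have "pword_over B ?v"
    using w(3) assms(2) by (force simp: pword_over_def)
  moreover have "holes ?v = holes w"
    unfolding holes_def by (rule arg_cong[of _ _ card]) auto
  ultimately show "h \<in> hole_counts B n"
    using w by (auto simp: hole_counts_def intro!: exI[of _ ?v])
qed

lemma Max_hole_counts_eq_HB:
  assumes "finite A" "card A = k"
  shows "Max (hole_counts A n) = HB k n"
proof -
  obtain f where f: "bij_betw f A {..<k}"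
    using assms by (metis finite_same_card_bij finite_lessThan card_lessThan)
  have "hole_counts A n = hole_counts {..<k} n"
  proof
    show "hole_counts A n \<subseteq> hole_counts {..<k} n"
      using f by (intro hole_counts_subset[of f]) (auto simp: bij_betw_def)
    show "hole_counts {..<k} n \<subseteq> hole_counts A n"
      using bij_betw_inv_into[OF f]
      by (intro hole_counts_subset[of "inv_into A f"]) (auto simp: bij_betw_def)
  qed
  then show ?thesis by (simp add: HB_def)
qed

end

theory Submission
  imports Defs "HOL-Analysis.Complex_Transcendental"
begin

text \<open>
  In an unbordered word every shift \<open>1, \<dots>, n - 1\<close> is a difference of two letter positions, so
  the set \<open>D\<close> of letter positions is a restricted difference basis. For every real \<open>\<theta>\<close>,
  \<open>\<Sum>a, b \<in> D. cos ((a - b) \<theta>) = \<bar>\<Sum>a \<in> D. exp (\<i> a \<theta>)\<bar>\<^sup>2 \<ge> 0\<close>,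
  and since \<open>1 - cos\<close> is nonnegative, discarding all but one representation of each difference
  \<open>d\<close> with \<open>\<bar>d\<bar> < n\<close> gives \<open>\<bar>D\<bar>\<^sup>2 \<ge> \<Sum>d. 1 - cos (d \<theta>)\<close>. The right-hand side is
  \<open>2 n - 1 - sin ((2 n - 1) \<theta> / 2) / sin (\<theta> / 2)\<close> by the Dirichlet kernel. Taking
  \<open>(2 n - 1) \<theta> / 2 = 4.5\<close>, close to the minimum of \<open>sin y / y\<close>, yields the constant.
\<close>

lemma sum_cos_diff_nonneg:
  fixes f :: "'a \<Rightarrow> real"
  shows "0 \<le> (\<Sum>(a, b)\<in>D \<times> D. cos (f a - f b))"
proof -
  have "(\<Sum>(a, b)\<in>D \<times> D. cos (f a - f b)) = (\<Sum>a\<in>D. \<Sum>b\<in>D. cos (f a - f b))"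
    by (simp add: sum.cartesian_product)
  also have "\<dots> = (\<Sum>a\<in>D. cos (f a))\<^sup>2 + (\<Sum>a\<in>D. sin (f a))\<^sup>2"
    by (simp add: cos_diff sum.distrib power2_eq_square sum_product)
  finally show ?thesis by simp
qed

text \<open>Here \<open>x\<close> is half the angle. Multiplying by \<open>sin x\<close> makes the
  induction telescope: the new terms \<open>d = - (N + 1)\<close> and \<open>d = N + 1\<close>
  together add \<open>sin ((2 * N + 3) * x) - sin ((2 * N + 1) * x)\<close>.\<close>

lemma dirichlet_kernel:
  fixes x :: real
  shows "sin x * (\<Sum>d\<in>{- int N..int N}. cos (of_int d * (2 * x))) = sin (real (2 * N + 1) * x)"
proof (induction N)
  case 0
  show ?case by simp
next
  case (Suc N)
  have "{- int (Suc N)..int (Suc N)} = insert (- int (Suc N)) (insert (int (Suc N)) {- int N..int N})"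
    by auto
  then have "(\<Sum>d\<in>{- int (Suc N)..int (Suc N)}. cos (of_int d * (2 * x)))
      = cos (- (real (Suc N) * (2 * x))) + (cos (real (Suc N) * (2 * x))
        + (\<Sum>d\<in>{- int N..int N}. cos (of_int d * (2 * x))))"
    by (simp del: cos_minus) (simp add: algebra_simps)
  then have "sin x * (\<Sum>d\<in>{- int (Suc N)..int (Suc N)}. cos (of_int d * (2 * x)))
      = 2 * (sin x * cos (real (Suc N) * (2 * x))) + sin (real (2 * N + 1) * x)"
    unfolding Suc.IH[symmetric] cos_minus by (simp only: distrib_left mult_2 add.assoc)
  also have "2 * (sin x * cos (real (Suc N) * (2 * x)))
      = sin (real (2 * Suc N + 1) * x) - sin (real (2 * N + 1) * x)"
    using sin_add[of "real (Suc N) * (2 * x)" x] sin_diff[of "real (Suc N) * (2 * x)" x]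
    by (simp add: algebra_simps)
  finally show ?case by simp
qed

lemma cos_ge_quadratic: "1 - x\<^sup>2 / 2 \<le> cos x" for x :: real
proof -
  have "(sin (x / 2))\<^sup>2 \<le> (x / 2)\<^sup>2"
    using abs_sin_x_le_abs_x[of "x / 2"] abs_le_square_iff by blast
  then show ?thesis
    using cos_double_sin[of "x / 2"] by (simp add: power_divide)
qed

lemma sin_9_2_le: "sin (9 / 2) \<le> (- 0.97 :: real)"
proof -
  \<comment> \<open>\<open>9 / 2\<close> lies just below \<open>3 / 2 * pi\<close>, where the sine
    is -1, so the quadratic bound on \<open>cos t\<close> for this small \<open>t\<close>
    suffices.\<close>
  define t where "t = 3 / 2 * pi - 9 / 2"
  have t: "0 \<le> t" "t \<le> 0.22"
    using pi_approx by (auto simp: t_def)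
  have "sin (9 / 2) = - cos t"
    using sin_diff[of "3 / 2 * pi" t] sin_3over2_pi cos_3over2_pi by (simp add: t_def)
  moreover have "t\<^sup>2 \<le> 0.22\<^sup>2"
    using t by (intro power_mono) auto
  ultimately show ?thesis
    using cos_ge_quadratic[of t] by (simp add: power2_eq_square)
qed

lemma difference_basis_card:
  fixes D :: "int set"
  assumes "finite D" and diffs: "\<And>d. 1 \<le> d \<Longrightarrow> d \<le> int N \<Longrightarrow> \<exists>a\<in>D. a + d \<in> D"
    and "1 \<le> N"
  shows "2.43 * real N \<le> (real (card D))\<^sup>2"
proof -
  define M where "M = real (2 * N + 1)"
  \<comment> \<open>With \<open>M\<close> the number of integers in \<open>{- int N..int N}\<close>,
    this makes the numerator of the Dirichlet kernel
    \<open>sin (M * x) = sin (9 / 2)\<close>.\<close>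
  define x where "x = 9 / 2 / M"
  define g where "g d = 1 - cos (of_int d * (2 * x))" for d :: int
  let ?\<delta> = "\<lambda>(a, b). a - b :: int"
  have "D \<noteq> {}" using diffs[of 1] \<open>1 \<le> N\<close> by auto
  have M: "3 \<le> M" using \<open>1 \<le> N\<close> by (simp add: M_def)
  have x: "0 < x" "x \<le> 1.5"
    using M by (auto simp: x_def field_simps)
  have sin_pos: "0 < sin x" using x pi_gt3 by (intro sin_gt_zero) auto
  have "d \<in> ?\<delta> ` (D \<times> D)" if "d \<in> {- int N..int N}" for d
  proof -
    consider "d = 0" | "1 \<le> d" | "1 \<le> - d" by linarith
    then show ?thesis
    proof cases
      case 1
      with \<open>D \<noteq> {}\<close> show ?thesis by force
    next
      case 2
      with diffs[of d] that show ?thesis by force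
    next
      case 3
      with diffs[of "- d"] that obtain a where "a \<in> D" "a - d \<in> D" by auto
      then have "(a, a - d) \<in> D \<times> D" by simp
      then show ?thesis by (rule rev_image_eqI) simp
    qed
  qed
  \<comment> \<open>\<open>g \<ge> 0\<close> is used twice: to admit differences beyond
    \<open>N\<close>, then to count each difference once per pair representing it.\<close>
  then have "(\<Sum>d\<in>{- int N..int N}. g d) \<le> (\<Sum>d\<in>?\<delta> ` (D \<times> D). g d)"
    using \<open>finite D\<close> by (intro sum_mono2) (auto simp: g_def)
  also have "\<dots> \<le> (\<Sum>p\<in>D \<times> D. g (?\<delta> p))"
    using sum_image_le[of "D \<times> D" g ?\<delta>] \<open>finite D\<close> by (simp add: g_def o_def)
  also have "\<dots> = (real (card D))\<^sup>2 - (\<Sum>(a, b)\<in>D \<times> D. cos (of_int a * (2 * x) - of_int b * (2 * x)))"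
    by (simp add: g_def case_prod_unfold sum_subtractf card_cartesian_product power2_eq_square
        left_diff_distrib)
  also have "\<dots> \<le> (real (card D))\<^sup>2"
    using sum_cos_diff_nonneg[of "\<lambda>a. of_int a * (2 * x)" D] by simp
  finally have "(\<Sum>d\<in>{- int N..int N}. g d) \<le> (real (card D))\<^sup>2" .
  moreover have "(\<Sum>d\<in>{- int N..int N}. g d) = M - sin (9 / 2) / sin x"
  proof -
    have "(\<Sum>d\<in>{- int N..int N}. cos (of_int d * (2 * x))) = sin (9 / 2) / sin x"
      using dirichlet_kernel[of x N] sin_pos M
      unfolding M_def[symmetric] by (simp add: x_def eq_divide_eq mult.commute)
    then show ?thesis by (simp add: g_def sum_subtractf M_def)
  qed
  moreover have "0.215 * M \<le> - sin (9 / 2) / sin x"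
  proof -
    \<comment> \<open>\<open>0.215 * 4.5 = 0.9675\<close>, just under the 0.97 available from
      \<open>sin_9_2_le\<close>.\<close>
    have "0.215 * M = 0.9675 / x" using M by (simp add: x_def)
    also have "\<dots> \<le> 0.9675 / sin x"
      using sin_x_le_x[of x] x sin_pos by (intro divide_left_mono) auto
    also have "\<dots> \<le> - sin (9 / 2) / sin x"
      using sin_9_2_le sin_pos by (intro divide_right_mono) auto
    finally show ?thesis .
  qed
  \<comment> \<open>As \<open>1.215 * M = 2.43 * N + 1.215\<close>, the claim follows by dropping
    the constant.\<close>
  ultimately have "1.215 * M \<le> (real (card D))\<^sup>2" by simp
  then show ?thesis by (simp add: M_def)
qed

text \<open>The prefix and suffix of length \<open>length w - d\<close> align position
  \<open>i\<close> with \<open>i + d\<close>; a clash between them needs letters at both.\<close>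

lemma unbordered_letters_at_distance:
  assumes "unbordered w" "0 < d" "d < length w"
  obtains i where "i + d < length w" "w ! i \<noteq> None" "w ! (i + d) \<noteq> None"
proof -
  let ?m = "length w - d"
  have "\<not> compatible (take ?m w) (drop d w)"
    using assms unfolding unbordered_def by (metis diff_diff_cancel diff_less less_imp_le
        order.strict_trans zero_less_diff)
  then show ?thesis
    using that assms(3) unfolding compatible_def by (auto simp: add.commute less_diff_conv)
qed

lemma unbordered_holes_le:
  assumes "unbordered w" "1 \<le> length w"
  shows "real (holes w) \<le> real (length w) - sqrt (2.43 * (real (length w) - 1))"
proof -
  define n where "n = length w"
  define L where "L = {i. i < n \<and> w ! i \<noteq> None}"
  have "{..<n} = {i. i < n \<and> w ! i = None} \<union> L" by (auto simp: L_def)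
  then have "n = card ({i. i < n \<and> w ! i = None} \<union> L)" by (metis card_lessThan)
  also have "\<dots> = holes w + card L"
    unfolding holes_def n_def[symmetric] by (intro card_Un_disjoint) (auto simp: L_def)
  finally have holes: "n = holes w + card L" .
  have "sqrt (2.43 * (real n - 1)) \<le> card L"
  \<comment> \<open>For \<open>n = 1\<close> the root is 0; \<open>difference_basis_card\<close>
    needs \<open>N = n - 1\<close> to be positive.\<close>
  proof (cases "n = 1")
    case False
    with assms(2) have n: "2 \<le> n" by (simp add: n_def)
    have diffs: "\<exists>a\<in>int ` L. a + d \<in> int ` L" if d: "1 \<le> d" "d \<le> int (n - 1)" for d
    proof -
      have "0 < nat d" "nat d < length w" using d n by (auto simp: n_def)
      with assms(1) obtain i where "i + nat d < length w" "w ! i \<noteq> None" "w ! (i + nat d) \<noteq> None"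
        by (rule unbordered_letters_at_distance)
      then have "i \<in> L" "i + nat d \<in> L" by (auto simp: L_def n_def)
      moreover have "int i + d = int (i + nat d)" using d by simp
      ultimately show ?thesis by (metis imageI)
    qed
    moreover have "finite (int ` L)" by (simp add: L_def)
    ultimately have "2.43 * real (n - 1) \<le> (real (card (int ` L)))\<^sup>2"
      using n by (intro difference_basis_card) auto
    then show ?thesis
      using n by (intro real_le_lsqrt) (auto simp: card_image of_nat_diff)
  qed simp
  then show ?thesis using holes by (simp add: n_def[symmetric])
qed

theorem theorem4:
  fixes k n :: nat
  assumes "k \<ge> 2" and "n \<ge> 1"
  shows "real (HB k n) \<le> real n - sqrt (2.43 * (real n - 1))"
proof -
  \<comment> \<open>Two distinct letters make the set nonempty, so \<open>Max\<close> is attained by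
    an actual word.\<close>
  have "hole_counts {..<k} n \<noteq> {}"
    using assms(1) by (intro hole_counts_nonempty[of 0 _ 1]) auto
  then have "HB k n \<in> hole_counts {..<k} n"
    unfolding HB_def by (intro Max_in finite_hole_counts)
  then obtain w :: "nat pword" where "HB k n = holes w" "length w = n" "unbordered w"
    by (auto simp: hole_counts_def)
  with unbordered_holes_le[of w] assms(2) show ?thesis by simp
qed

end
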